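(* Let $f,g$ be trigonometric polynomials on the unit circle $\mathbb{S}^1$. Then the commutator $[T_f,T_g]$ is a finite-rank operator, and $$\sum_{j\ge 0}\omega_j(T_f,T_g)=\mathrm{tr}\,[T_f,T_g]=\frac{1}{2\pi i}\oint_{\mathbb{S}^1} f\,dg .$$ In particular, for every $n\ge 1$, taking $f(z)=z^n$ and $g(z)=z^{-n}$ gives $$\sum_{j\ge 0}\omega_j\bigl(U^n,(U^* )^n\bigr)=-n=\operatorname{index}(U^n),$$ and $\omega_j(U^n,(U^* )^n)=-\mathbf{1}_{\{j<n\}}$ for every $j\ge0$, so that the index $-n$ is the sum of $n$ unit contributions $-1$ from the sites $j=0,\dots,n-1$.
   Context: Let $(e_n)_{n\ge 0}$ be the canonical orthonormal basis of $\ell^2(\mathbb{Z}_{\ge 0})$ (inner product linear in the second argument), and let $U$ be the forward unilateral shift, $Ue_n=e_{n+1}$, with adjoint $U^*e_n=e_{n-1}$ for $n\ge1$ and $U^*e_0=0$. For a trigonometric polynomial $f(z)=\sum_k \hat f_k z^k$ (finite sum over $k\in\mathbb{Z}$), the Toeplitz operator $T_f$ on $\ell^2(\mathbb{Z}_{\ge0})$ is defined linearly by $T_{z^k}=U^k$ and $T_{z^{-k}}=(U^* )^k$ for $k\ge 0$. For bounded operators $X,Y$ and $j\ge0$, set $\omega_j(X,Y)=\langle e_j,[X,Y]e_j\rangle$ with $[X,Y]=XY-YX$. The integral over $\mathbb{S}^1$ is taken counterclockwise, $dg=g'(z)\,dz$. The Fredholm index is $\operatorname{index}(A)=\dim\ker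 A-\dim\ker A^*$. $\mathbf{1}_{\{j<n\}}$ equals $1$ if $j<n$ and $0$ otherwise. *)

theory Defs
  imports
    "HOL-Complex_Analysis.Complex_Analysis"
    "HOL-Library.Poly_Mapping"
begin

typedef ell2 = "{x :: nat \<Rightarrow> complex. summable (\<lambda>n. (cmod (x n))\<^sup>2)}"
  morphisms coord Abs_ell2
  by (rule exI[of _ "\<lambda>_. 0"]) simp

setup_lifting type_definition_ell2

lemma ell2_eqI: "(\<And>n. coord x n = coord y n) \<Longrightarrow> x = y"
  by (simp add: coord_inject[symmetric] fun_eq_iff)

lemma summable_coord: "summable (\<lambda>n. (cmod (coord x n))\<^sup>2)"
  using coord[of x] by simp

lemma cmod_add_sq_le: "(cmod (a + b))\<^sup>2 \<le> 2 * (cmod a)\<^sup>2 + 2 * (cmod b)\<^sup>2"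
proof -
  have "(cmod (a + b))\<^sup>2 \<le> (cmod a + cmod b)\<^sup>2"
    by (intro power_mono norm_triangle_ineq) auto
  also have "\<dots> \<le> 2 * (cmod a)\<^sup>2 + 2 * (cmod b)\<^sup>2"
    using sum_squares_bound[of "cmod a" "cmod b"] by (simp add: power2_sum)
  finally show ?thesis .
qed

instantiation ell2 :: ab_group_add
begin

lift_definition zero_ell2 :: ell2 is "\<lambda>_. 0"
  by simp

lift_definition plus_ell2 :: "ell2 \<Rightarrow> ell2 \<Rightarrow> ell2" is "\<lambda>x y n. x n + y n"
proof -
  fix x y :: "nat \<Rightarrow> complex"
  assume "summable (\<lambda>n. (cmod (x n))\<^sup>2)" "summable (\<lambda>n. (cmod (y n))\<^sup>2)"
  then have "summable (\<lambda>n. 2 * (cmod (x n))\<^sup>2 + 2 * (cmod (y n))\<^sup>2)"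
    by (intro summable_add summable_mult)
  then show "summable (\<lambda>n. (cmod (x n + y n))\<^sup>2)"
    by (rule summable_comparison_test'[where N = 0]) (simp add: cmod_add_sq_le)
qed

lift_definition uminus_ell2 :: "ell2 \<Rightarrow> ell2" is "\<lambda>x n. - x n"
  by simp

definition minus_ell2 :: "ell2 \<Rightarrow> ell2 \<Rightarrow> ell2" where
  "minus_ell2 x y = x + (- y)"

instance
  by standard
    (auto intro!: ell2_eqI simp: minus_ell2_def zero_ell2.rep_eq plus_ell2.rep_eq
      uminus_ell2.rep_eq)

end

lift_definition scaleC :: "complex \<Rightarrow> ell2 \<Rightarrow> ell2" (infixr "*\<^sub>C" 75) is "\<lambda>c x n. c * x n"
proof -
  fix c :: complex and x :: "nat \<Rightarrow> complex"
  assume "summable (\<lambda>n. (cmod (x n))\<^sup>2)"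
  from summable_mult[OF this, of "(cmod c)\<^sup>2"]
  show "summable (\<lambda>n. (cmod (c * x n))\<^sup>2)"
    by (simp only: norm_mult power_mult_distrib)
qed

lemma coord_zero [simp]: "coord 0 n = 0"
  by (simp add: zero_ell2.rep_eq)
lemma coord_add [simp]: "coord (x + y) n = coord x n + coord y n"
  by (simp add: plus_ell2.rep_eq)
lemma coord_uminus [simp]: "coord (- x) n = - coord x n"
  by (simp add: uminus_ell2.rep_eq)
lemma coord_diff [simp]: "coord (x - y) n = coord x n - coord y n"
  by (simp only: minus_ell2_def coord_add coord_uminus) simp
lemma coord_scaleC [simp]: "coord (c *\<^sub>C x) n = c * coord x n"
  by (simp add: scaleC.rep_eq)

text \<open>Complex linear algebra (\<open>ell2.span\<close>, \<open>ell2.dim\<close>, \dots) comes from this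
  interpretation; the unqualified \<open>span\<close> and \<open>dim\<close> are over the reals.\<close>

interpretation ell2: vector_space scaleC
  by unfold_locales (auto intro!: ell2_eqI simp: algebra_simps)

definition cinner :: "ell2 \<Rightarrow> ell2 \<Rightarrow> complex" where
  "cinner x y = suminf (\<lambda>n. cnj (coord x n) * coord y n)"

lemma summable_cinner: "summable (\<lambda>n. cnj (coord x n) * coord y n)"
proof (rule summable_norm_cancel, rule summable_comparison_test')
  show "summable (\<lambda>n. (cmod (coord x n))\<^sup>2 + (cmod (coord y n))\<^sup>2)"
    by (intro summable_add summable_coord)
  show "norm (norm (cnj (coord x n) * coord y n))
      \<le> (cmod (coord x n))\<^sup>2 + (cmod (coord y n))\<^sup>2" for n
  proof -
    have "2 * (cmod (coord x n) * cmod (coord y n)) \<le> (cmod (coord x n))\<^sup>2 + (cmod (coord y n))\<^sup>2"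
      using sum_squares_bound[of "cmod (coord x n)" "cmod (coord y n)"] by simp
    moreover have "0 \<le> cmod (coord x n) * cmod (coord y n)" by simp
    ultimately show ?thesis unfolding real_norm_def norm_mult complex_mod_cnj abs_mult abs_norm_cancel by linarith
  qed
qed

lemma cinner_add_left: "cinner (x + y) z = cinner x z + cinner y z"
  unfolding cinner_def using suminf_add[OF summable_cinner summable_cinner, of x z y z]
  by (simp add: algebra_simps)

lemma cinner_scaleC_left: "cinner (c *\<^sub>C x) y = cnj c * cinner x y"
  unfolding cinner_def using suminf_mult[OF summable_cinner, of "cnj c" x y]
  by (simp add: algebra_simps)

lemma cinner_commute: "cinner x y = cnj (cinner y x)"
  unfolding cinner_def
  using bounded_linear.suminf[OF bounded_linear_cnj summable_cinner, of y x]
  by (simp add: mult.commute)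

lemma cinner_self: "cinner x x = of_real (suminf (\<lambda>n. (cmod (coord x n))\<^sup>2))"
proof -
  have "cnj a * a = complex_of_real ((cmod a)\<^sup>2)" for a
    by (metis complex_norm_square mult.commute)
  then show ?thesis
    unfolding cinner_def by (simp only: suminf_of_real[OF summable_coord])
qed

text \<open>The norm and the topology are those of the real inner product \<open>Re \<langle>x, y\<rangle>\<close>, whose norm is
  the usual one as \<open>\<langle>x, x\<rangle>\<close> is real.\<close>

instantiation ell2 :: real_inner
begin

definition scaleR_ell2 :: "real \<Rightarrow> ell2 \<Rightarrow> ell2" where
  "scaleR_ell2 r x = complex_of_real r *\<^sub>C x"

definition inner_ell2 :: "ell2 \<Rightarrow> ell2 \<Rightarrow> real" where
  "inner_ell2 x y = Re (cinner x y)"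

definition norm_ell2 :: "ell2 \<Rightarrow> real" where
  "norm_ell2 x = sqrt (Re (cinner x x))"

definition dist_ell2 :: "ell2 \<Rightarrow> ell2 \<Rightarrow> real" where
  "dist_ell2 x y = norm (x - y)"

definition sgn_ell2 :: "ell2 \<Rightarrow> ell2" where
  "sgn_ell2 x = inverse (norm x) *\<^sub>R x"

definition uniformity_ell2 :: "(ell2 \<times> ell2) filter" where
  "uniformity_ell2 = (INF e\<in>{0<..}. principal {(x, y). dist x y < e})"

definition open_ell2 :: "ell2 set \<Rightarrow> bool" where
  "open_ell2 S = (\<forall>x\<in>S. \<forall>\<^sub>F (x', y) in uniformity. x' = x \<longrightarrow> y \<in> S)"

instance
proof
  fix x y z :: ell2 and r s :: real
  show "r *\<^sub>R (x + y) = r *\<^sub>R x + r *\<^sub>R y" "(r + s) *\<^sub>R x = r *\<^sub>R x + s *\<^sub>R x"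
    "r *\<^sub>R s *\<^sub>R x = (r * s) *\<^sub>R x" "1 *\<^sub>R x = x"
    by (simp_all add: scaleR_ell2_def ell2.scale_right_distrib ell2.scale_left_distrib)
  show "dist x y = norm (x - y)" by (fact dist_ell2_def)
  show "sgn x = inverse (norm x) *\<^sub>R x" by (fact sgn_ell2_def)
  show "(uniformity :: (ell2 \<times> ell2) filter) = (INF e\<in>{0<..}. principal {(x, y). dist x y < e})"
    by (fact uniformity_ell2_def)
  show "open U = (\<forall>x\<in>U. \<forall>\<^sub>F (x', y) in uniformity. x' = x \<longrightarrow> y \<in> U)" for U :: "ell2 set"
    by (fact open_ell2_def)
  show "x \<bullet> y = y \<bullet> x"
    unfolding inner_ell2_def using cinner_commute[of x y] by simp
  show "(x + y) \<bullet> z = x \<bullet> z + y \<bullet> z" "(r *\<^sub>R x) \<bullet> y = r * (x \<bullet> y)"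
    by (simp_all add: inner_ell2_def scaleR_ell2_def cinner_add_left cinner_scaleC_left)
  show "0 \<le> x \<bullet> x"
    by (simp add: inner_ell2_def cinner_self suminf_nonneg summable_coord)
  show "x \<bullet> x = 0 \<longleftrightarrow> x = 0"
  proof -
    have "x \<bullet> x = 0 \<longleftrightarrow> (\<forall>n. coord x n = 0)"
      by (simp add: inner_ell2_def cinner_self suminf_eq_zero_iff[OF summable_coord])
    also have "\<dots> \<longleftrightarrow> x = 0"
      by (metis coord_zero ell2_eqI)
    finally show ?thesis .
  qed
  show "norm x = sqrt (x \<bullet> x)"
    by (simp add: norm_ell2_def inner_ell2_def)
qed

end

lift_definition basis_vec :: "nat \<Rightarrow> ell2" is "\<lambda>k n. if n = k then 1 else 0"
proof -
  fix k :: nat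
  show "summable (\<lambda>n. (cmod (if n = k then 1 else 0))\<^sup>2)"
    by (rule summable_finite[of "{k}"]) auto
qed

definition is_onb :: "(nat \<Rightarrow> ell2) \<Rightarrow> bool" where
  "is_onb b \<longleftrightarrow> (\<forall>i j. cinner (b i) (b j) = (if i = j then 1 else 0)) \<and>
     closure (ell2.span (range b)) = UNIV"

definition bounded_clinear :: "(ell2 \<Rightarrow> ell2) \<Rightarrow> bool" where
  "bounded_clinear A \<longleftrightarrow> bounded_linear A \<and> (\<forall>c x. A (c *\<^sub>C x) = c *\<^sub>C A x)"

definition cadjoint :: "(ell2 \<Rightarrow> ell2) \<Rightarrow> ell2 \<Rightarrow> ell2" where
  "cadjoint A = (THE B. \<forall>x y. cinner (A x) y = cinner x (B y))"

definition commutator :: "(ell2 \<Rightarrow> ell2) \<Rightarrow> (ell2 \<Rightarrow> ell2) \<Rightarrow> ell2 \<Rightarrow> ell2" where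
  "commutator X Y = (\<lambda>x. X (Y x) - Y (X x))"

definition omega :: "nat \<Rightarrow> (ell2 \<Rightarrow> ell2) \<Rightarrow> (ell2 \<Rightarrow> ell2) \<Rightarrow> complex" where
  "omega j X Y = cinner (basis_vec j) (commutator X Y (basis_vec j))"

definition finite_dim :: "ell2 set \<Rightarrow> bool" where
  "finite_dim V \<longleftrightarrow> (\<exists>B. finite B \<and> V \<subseteq> ell2.span B)"

definition finite_rank :: "(ell2 \<Rightarrow> ell2) \<Rightarrow> bool" where
  "finite_rank A \<longleftrightarrow> bounded_clinear A \<and> finite_dim (range A)"

text \<open>The trace is required to be computed by every orthonormal basis, not only by the
  canonical one.\<close>

definition op_trace :: "(ell2 \<Rightarrow> ell2) \<Rightarrow> complex" where
  "op_trace A = (THE t. \<forall>b. is_onb b \<longrightarrow> (\<lambda>j. cinner (b j) (A (b j))) sums t)"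

definition ker :: "(ell2 \<Rightarrow> ell2) \<Rightarrow> ell2 set" where
  "ker A = {x. A x = 0}"

definition fredholm :: "(ell2 \<Rightarrow> ell2) \<Rightarrow> bool" where
  "fredholm A \<longleftrightarrow> bounded_clinear A \<and> closed (range A) \<and>
     finite_dim (ker A) \<and> finite_dim (ker (cadjoint A))"

text \<open>Only meaningful for Fredholm operators: \<open>ell2.dim\<close> of an infinite-dimensional space is 0.\<close>

definition fredholm_index :: "(ell2 \<Rightarrow> ell2) \<Rightarrow> int" where
  "fredholm_index A = int (ell2.dim (ker A)) - int (ell2.dim (ker (cadjoint A)))"

lift_definition shift :: "ell2 \<Rightarrow> ell2" is "\<lambda>x n. if n = 0 then 0 else x (n - 1)"
proof -
  fix x :: "nat \<Rightarrow> complex"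
  assume "summable (\<lambda>n. (cmod (x n))\<^sup>2)"
  then show "summable (\<lambda>n. (cmod (if n = 0 then 0 else x (n - 1)))\<^sup>2)"
    by (subst summable_Suc_iff[symmetric]) simp
qed

lift_definition backward_shift :: "ell2 \<Rightarrow> ell2" is "\<lambda>x n. x (Suc n)"
  by (subst summable_Suc_iff)

lemma shift_basis_vec: "shift (basis_vec n) = basis_vec (Suc n)"
  by (rule ell2_eqI) (auto simp: shift.rep_eq basis_vec.rep_eq)

lemma cadjoint_shift: "cadjoint shift = backward_shift"
proof -
  have adj: "cinner (shift x) y = cinner x (backward_shift y)" for x y
    unfolding cinner_def using suminf_split_head[OF summable_cinner, of "shift x" y]
    by (simp add: shift.rep_eq backward_shift.rep_eq)
  have cinner_basis: "cinner (basis_vec n) y = coord y n" for n y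
    unfolding cinner_def
    by (subst suminf_finite[of "{n}"]) (auto simp: basis_vec.rep_eq)
  show ?thesis
    unfolding cadjoint_def
  proof (rule the_equality)
    show "\<forall>x y. cinner (shift x) y = cinner x (backward_shift y)"
      using adj by blast
    fix B assume B: "\<forall>x y. cinner (shift x) y = cinner x (B y)"
    show "B = backward_shift"
    proof (rule ext, rule ell2_eqI)
      fix y n
      show "coord (B y) n = coord (backward_shift y) n"
        using B[rule_format, of "basis_vec n" y] adj[of "basis_vec n" y]
        by (simp only: cinner_basis)
    qed
  qed
qed

lemma cadjoint_shift_basis_vec:
  "cadjoint shift (basis_vec n) = (if n = 0 then 0 else basis_vec (n - 1))"
  by (rule ell2_eqI) (auto simp: cadjoint_shift backward_shift.rep_eq basis_vec.rep_eq)

text \<open>A trigonometric polynomial is its finitely supported family of coefficients.\<close>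

type_synonym trig_poly = "int \<Rightarrow>\<^sub>0 complex"

definition trig_eval :: "trig_poly \<Rightarrow> complex \<Rightarrow> complex" where
  "trig_eval f z = (\<Sum>k\<in>Poly_Mapping.keys f. Poly_Mapping.lookup f k * z powi k)"

definition trig_monom :: "int \<Rightarrow> trig_poly" where
  "trig_monom k = Poly_Mapping.single k 1"

lemma trig_eval_monom: "trig_eval (trig_monom k) z = z powi k"
  by (simp add: trig_eval_def trig_monom_def)

definition toeplitz_monom :: "int \<Rightarrow> ell2 \<Rightarrow> ell2" where
  "toeplitz_monom k = (if k \<ge> 0 then shift ^^ nat k else cadjoint shift ^^ nat (- k))"

definition toeplitz :: "trig_poly \<Rightarrow> ell2 \<Rightarrow> ell2" where
  "toeplitz f x = (\<Sum>k\<in>Poly_Mapping.keys f. Poly_Mapping.lookup f k *\<^sub>C toeplitz_monom k x)"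

end

theory Submission imports Defs begin

text \<open>By bilinearity it suffices to treat \<open>f = z\<^sup>k\<close> and \<open>g = z\<^sup>l\<close>. The operator \<open>T\<^sub>k\<close> shifts
  coordinates by \<open>k\<close>, discarding what leaves the half-line, so \<open>[T\<^sub>k, T\<^sub>l]\<close> vanishes on \<open>e\<^sub>j\<close> for
  \<open>j \<ge> max \<bar>k\<bar> \<bar>l\<bar>\<close> and is a finite sum of operators \<open>x \<mapsto> \<langle>e\<^sub>j, x\<rangle> v\<close>. Each of these has trace
  \<open>\<langle>e\<^sub>j, v\<rangle>\<close> in every orthonormal basis by Parseval's identity. The diagonal entries are nonzero only
  if \<open>k + l = 0\<close>, where they sum to \<open>l\<close>; this is also the coefficient of \<open>z\<^sup>-\<^sup>1\<close> in \<open>f g'\<close>.\<close>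

section \<open>The Hilbert space\<close>

lemma cinner_add_right: "cinner x (y + z) = cinner x y + cinner x z"
  by (metis cinner_add_left cinner_commute complex_cnj_add)

lemma cinner_scaleC_right: "cinner x (c *\<^sub>C y) = c * cinner x y"
  by (metis cinner_commute cinner_scaleC_left complex_cnj_cnj complex_cnj_mult)

lemma cinner_zero_right [simp]: "cinner x 0 = 0"
  by (simp add: cinner_def)

lemma cinner_diff_right: "cinner x (y - z) = cinner x y - cinner x z"
  using cinner_add_right[of x "y - z" z] by (simp add: algebra_simps)

lemma cinner_sum_right: "cinner x (sum f A) = (\<Sum>i\<in>A. cinner x (f i))"
  by (induction A rule: infinite_finite_induct) (simp_all add: cinner_add_right)

lemma coord_sum [simp]: "coord (sum f A) n = (\<Sum>i\<in>A. coord (f i) n)"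
  by (induction A rule: infinite_finite_induct) simp_all

lemma coord_basis_vec [simp]: "coord (basis_vec k) n = (if n = k then 1 else 0)"
  by (simp add: basis_vec.rep_eq)

lemma cinner_basis_vec_left [simp]: "cinner (basis_vec n) y = coord y n"
  unfolding cinner_def by (subst suminf_finite[of "{n}"]) auto

lemma norm_ell2_sq: "(norm x)\<^sup>2 = suminf (\<lambda>n. (cmod (coord x n))\<^sup>2)"
  by (simp add: norm_ell2_def cinner_self suminf_nonneg summable_coord)

lemma norm_scaleC: "norm (c *\<^sub>C x) = cmod c * norm x"
proof (rule power2_eq_imp_eq)
  show "(norm (c *\<^sub>C x))\<^sup>2 = (cmod c * norm x)\<^sup>2"
    by (simp add: norm_ell2_sq norm_mult power_mult_distrib suminf_mult summable_coord)
qed auto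

lemma norm_basis_vec [simp]: "norm (basis_vec n) = 1"
  by (simp add: norm_ell2_def)

text \<open>Cauchy-Schwarz for the complex pairing, reduced to the one for its real part: rotating
  \<open>x\<close> by the phase of \<open>cinner x y\<close> makes the pairing real and
  nonnegative.\<close>

lemma cmod_cinner_le: "cmod (cinner x y) \<le> norm x * norm y"
proof -
  define c where "c = sgn (cinner x y)"
  have "cnj c * cinner x y = complex_of_real (cmod (cinner x y))"
    unfolding c_def sgn_eq
    by (cases "cinner x y = 0")
      (simp_all add: divide_simps mult.commute[of "cnj _"] complex_norm_square[symmetric] power2_eq_square)
  then have "cmod (cinner x y) = (c *\<^sub>C x) \<bullet> y"
    by (simp add: inner_ell2_def cinner_scaleC_left)
  also have "\<dots> \<le> norm (c *\<^sub>C x) * norm y"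
    by (rule norm_cauchy_schwarz)
  also have "\<dots> \<le> norm x * norm y"
    \<comment> \<open>Since \<open>sgn 0 = 0\<close>, the modulus of \<open>c\<close> is 1 or 0;
      hence an inequality here, not an equality.\<close>
    by (intro mult_right_mono) (auto simp: norm_scaleC c_def norm_sgn)
  finally show ?thesis .
qed

lemma cmod_coord_le: "cmod (coord x n) \<le> norm x"
  using cmod_cinner_le[of "basis_vec n" x] by simp

lemma coord_sum_basis_vec:
  "coord (\<Sum>j<n. c j *\<^sub>C basis_vec j) k = (if k < n then c k else 0)"
proof -
  have "coord (\<Sum>j<n. c j *\<^sub>C basis_vec j) k = (\<Sum>j<n. if k = j then c j else 0)"
    unfolding coord_sum by (rule sum.cong) auto
  then show ?thesis by simp
qed

lemma sum_coord_basis_vec: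
  assumes "\<And>k. n \<le> k \<Longrightarrow> coord x k = 0"
  shows "x = (\<Sum>j<n. coord x j *\<^sub>C basis_vec j)"
  by (rule ell2_eqI) (use assms in \<open>simp add: coord_sum_basis_vec del: coord_sum\<close>)

lemma inj_basis_vec: "inj basis_vec"
proof (rule injI)
  fix m n assume "basis_vec m = basis_vec n"
  then have "coord (basis_vec m) m = coord (basis_vec n) m" by simp
  then show "m = n" by (simp split: if_splits)
qed

text \<open>Reading off coordinate \<open>j\<close> of a vanishing combination isolates its
  \<open>j\<close>-th coefficient. This gives the dimension of the cokernel in the index
  computation.\<close>

lemma independent_basis_vec: "ell2.independent (basis_vec ` {..<n})"
proof (rule ell2.independent_if_scalars_zero)
  fix u x assume u: "(\<Sum>v\<in>basis_vec ` {..<n}. u v *\<^sub>C v) = 0" and x: "x \<in> basis_vec ` {..<n}"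
  obtain j where j: "j < n" "x = basis_vec j" using x by auto
  have "coord (\<Sum>i<n. u (basis_vec i) *\<^sub>C basis_vec i) j = 0"
    using u by (subst (asm) sum.reindex) (auto simp: inj_on_subset[OF inj_basis_vec])
  then show "u x = 0" using j by (simp add: coord_sum_basis_vec del: coord_sum)
qed simp

section \<open>Orthonormal bases\<close>

text \<open>Density supplies some finite combination \<open>s\<close> near \<open>x\<close>. The
  partial sum \<open>P n\<close> is the orthogonal projection of \<open>x\<close> onto the span of
  the first \<open>n\<close> vectors, so it is at least as near as soon as that span contains
  \<open>s\<close>.\<close>

lemma onb_expansion:
  assumes "is_onb b"
  shows "(\<lambda>n. \<Sum>j<n. cinner (b j) x *\<^sub>C b j) \<longlonglongrightarrow> x"
proof -
  define P where "P n = (\<Sum>j<n. cinner (b j) x *\<^sub>C b j)" for n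
  have orth: "cinner (b i) (b j) = (if i = j then 1 else 0)" for i j
    using assms by (simp add: is_onb_def)
  have best: "norm (x - P n) \<le> norm (x - s)" if "s \<in> ell2.span (b ` {..<n})" for s n
  proof -
    have "cinner (b j) (P n) = (\<Sum>i<n. if j = i then cinner (b i) x else 0)" for j
      unfolding P_def cinner_sum_right cinner_scaleC_right orth by (rule sum.cong) auto
    then have "cinner (x - P n) (b j) = 0" if "j < n" for j
      using that by (subst cinner_commute) (simp add: cinner_diff_right)
    \<comment> \<open>Orthogonality to the generators passes to their span because the annihilator
      of a vector is a subspace.\<close>
    then have "ell2.span (b ` {..<n}) \<subseteq> {s. cinner (x - P n) s = 0}"
      by (intro ell2.span_minimal)
        (auto simp: ell2.subspace_def cinner_add_right cinner_scaleC_right)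
    moreover have "P n - s \<in> ell2.span (b ` {..<n})"
      unfolding P_def using that
      by (intro ell2.span_diff ell2.span_sum ell2.span_scale) (auto intro: ell2.span_base)
    \<comment> \<open>A vanishing complex pairing has vanishing real part, so Pythagoras for the
      real inner product applies.\<close>
    ultimately have "orthogonal (x - P n) (P n - s)"
      by (auto simp: inner_ell2_def orthogonal_def)
    then have "(norm ((x - P n) + (P n - s)))\<^sup>2 = (norm (x - P n))\<^sup>2 + (norm (P n - s))\<^sup>2"
      by (rule norm_add_Pythagorean)
    then have "(norm (x - P n))\<^sup>2 \<le> (norm (x - s))\<^sup>2" by simp
    then show ?thesis by (rule power2_le_imp_le) simp
  qed
  \<comment> \<open>The spans of initial segments form an increasing chain, so their union is
    already a subspace.\<close>
  have ex: "\<exists>N. s \<in> ell2.span (b ` {..<N})" if "s \<in> ell2.span (range b)" for s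
  proof -
    have mono: "ell2.span (b ` {..<m}) \<subseteq> ell2.span (b ` {..<n})" if "m \<le> n" for m n
      using that by (intro ell2.span_mono) auto
    have "ell2.span (range b) \<subseteq> (\<Union>N. ell2.span (b ` {..<N}))"
    proof (rule ell2.span_minimal)
      show "range b \<subseteq> (\<Union>N. ell2.span (b ` {..<N}))"
      proof
        fix s assume "s \<in> range b"
        then obtain j where "s = b j" by blast
        then have "s \<in> ell2.span (b ` {..<Suc j})" by (simp add: ell2.span_base)
        then show "s \<in> (\<Union>N. ell2.span (b ` {..<N}))" by blast
      qed
      show "ell2.subspace (\<Union>N. ell2.span (b ` {..<N}))"
        unfolding ell2.subspace_def
      proof (intro conjI ballI allI)
        fix s t assume "s \<in> (\<Union>N. ell2.span (b ` {..<N}))" "t \<in> (\<Union>N. ell2.span (b ` {..<N}))"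
        then obtain M N where "s \<in> ell2.span (b ` {..<M})" "t \<in> ell2.span (b ` {..<N})" by auto
        then have "s + t \<in> ell2.span (b ` {..<max M N})"
          using mono[of M "max M N"] mono[of N "max M N"] by (intro ell2.span_add) auto
        then show "s + t \<in> (\<Union>N. ell2.span (b ` {..<N}))" by blast
      qed (auto intro: ell2.span_zero ell2.span_scale)
    qed
    then show ?thesis using that by blast
  qed
  show ?thesis
    unfolding P_def[symmetric]
  proof (rule metric_LIMSEQ_I)
    fix e :: real assume "e > 0"
    moreover have "x \<in> closure (ell2.span (range b))" using assms by (simp add: is_onb_def)
    ultimately obtain s where s: "s \<in> ell2.span (range b)" "dist s x < e"
      using closure_approachable by blast
    obtain N where N: "s \<in> ell2.span (b ` {..<N})" using ex[OF s(1)] by blast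
    have "dist (P n) x < e" if "n \<ge> N" for n
    proof -
      have "ell2.span (b ` {..<N}) \<subseteq> ell2.span (b ` {..<n})"
        using that by (intro ell2.span_mono) auto
      then have "norm (x - P n) \<le> norm (x - s)" using N best by blast
      then show ?thesis using s(2) by (simp add: dist_norm norm_minus_commute)
    qed
    then show "\<exists>N. \<forall>n\<ge>N. dist (P n) x < e" by blast
  qed
qed

text \<open>By Cauchy-Schwarz \<open>cinner u\<close> is continuous, so it may be applied term by
  term to the expansion of \<open>v\<close>.\<close>

lemma onb_parseval:
  assumes "is_onb b"
  shows "(\<lambda>j. cinner u (b j) * cinner (b j) v) sums cinner u v"
proof -
  define P where "P n = (\<Sum>j<n. cinner (b j) v *\<^sub>C b j)" for n
  have lim: "(\<lambda>n. norm u * norm (P n - v)) \<longlonglongrightarrow> norm u * 0"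
    using onb_expansion[OF assms, of v] unfolding P_def[symmetric]
    by (intro tendsto_mult_left tendsto_norm_zero LIM_zero)
  have "(\<lambda>n. cinner u (P n) - cinner u v) \<longlonglongrightarrow> 0"
  proof (rule Lim_null_comparison)
    show "\<forall>\<^sub>F n in sequentially. cmod (cinner u (P n) - cinner u v) \<le> norm u * norm (P n - v)"
      by (simp add: cmod_cinner_le flip: cinner_diff_right)
  qed (use lim in simp)
  then have "(\<lambda>n. cinner u (P n)) \<longlonglongrightarrow> cinner u v" by (rule LIM_zero_cancel)
  then show ?thesis
    by (simp add: sums_def P_def cinner_sum_right cinner_scaleC_right mult.commute)
qed

text \<open>For density, truncate \<open>x\<close> after \<open>n\<close> coordinates: the squared
  error is a tail of the convergent series of the \<open>(cmod (coord x k))\<^sup>2\<close>.\<close>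

lemma is_onb_basis_vec: "is_onb basis_vec"
  unfolding is_onb_def
proof (intro conjI allI)
  show "closure (ell2.span (range basis_vec)) = UNIV"
  proof (intro equalityI subset_UNIV subsetI)
    fix x :: ell2
    define P where "P n = (\<Sum>j<n. coord x j *\<^sub>C basis_vec j)" for n
    have coord_P: "coord (x - P n) k = (if k < n then 0 else coord x k)" for k n
      by (simp add: P_def coord_sum_basis_vec del: coord_sum)
    have norm_P: "(norm (x - P n))\<^sup>2 = suminf (\<lambda>k. (cmod (coord x (k + n)))\<^sup>2)" for n
    proof -
      have "(norm (x - P n))\<^sup>2 = suminf (\<lambda>k. (cmod (coord (x - P n) (k + n)))\<^sup>2)
          + (\<Sum>k<n. (cmod (coord (x - P n) k))\<^sup>2)"
        unfolding norm_ell2_sq by (rule suminf_split_initial_segment[OF summable_coord])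
      then show ?thesis by (simp only: coord_P) simp
    qed
    show "x \<in> closure (ell2.span (range basis_vec))"
      unfolding closure_approachable
    proof (intro allI impI)
      fix e :: real assume e: "0 < e"
      obtain N where "\<And>n. n \<ge> N \<Longrightarrow> norm (suminf (\<lambda>k. (cmod (coord x (k + n)))\<^sup>2)) < e\<^sup>2"
        using suminf_exist_split[OF _ summable_coord[of x], of "e\<^sup>2"] e by auto
      from this[of N] have "(norm (x - P N))\<^sup>2 < e\<^sup>2" by (simp flip: norm_P)
      then have "dist (P N) x < e"
        using e by (simp add: dist_norm norm_minus_commute power2_less_imp_less)
      moreover have "P N \<in> ell2.span (range basis_vec)"
        unfolding P_def by (intro ell2.span_sum ell2.span_scale ell2.span_base) auto
      ultimately show "\<exists>y\<in>ell2.span (range basis_vec). dist y x < e" by blast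
    qed
  qed
qed auto

section \<open>Traces of finite-rank operators\<close>

text \<open>\<open>op_trace\<close> is a definite description, awkward to combine algebraically.
  This relation carries finite rank and the value in every basis together, and is closed under
  linear combinations.\<close>

definition has_trace :: "(ell2 \<Rightarrow> ell2) \<Rightarrow> complex \<Rightarrow> bool" where
  "has_trace A t \<longleftrightarrow> finite_rank A \<and> (\<forall>b. is_onb b \<longrightarrow> (\<lambda>j. cinner (b j) (A (b j))) sums t)"

text \<open>Uniqueness relies on the existence of an orthonormal basis; the canonical one
  serves.\<close>

lemma op_trace_eqI:
  assumes "has_trace A t"
  shows "op_trace A = t"
  unfolding op_trace_def
proof (rule the_equality)
  show "\<forall>b. is_onb b \<longrightarrow> (\<lambda>j. cinner (b j) (A (b j))) sums t"
    using assms by (simp add: has_trace_def)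
next
  fix s assume "\<forall>b. is_onb b \<longrightarrow> (\<lambda>j. cinner (b j) (A (b j))) sums s"
  then show "s = t"
    using assms is_onb_basis_vec sums_unique2 unfolding has_trace_def by blast
qed

lemma finite_rank_zero: "finite_rank (\<lambda>x. 0)"
  by (auto simp: finite_rank_def bounded_clinear_def finite_dim_def intro!: exI[of _ "{}"])

lemma finite_rank_add:
  assumes "finite_rank A" "finite_rank B"
  shows "finite_rank (\<lambda>x. A x + B x)"
proof -
  obtain S T where ST: "finite S" "finite T" "range A \<subseteq> ell2.span S" "range B \<subseteq> ell2.span T"
    using assms unfolding finite_rank_def finite_dim_def by blast
  have "range (\<lambda>x. A x + B x) \<subseteq> ell2.span (S \<union> T)"
    using ST(3,4) ell2.span_mono[of S "S \<union> T"] ell2.span_mono[of T "S \<union> T"]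
    by (auto intro!: ell2.span_add)
  then have "finite_dim (range (\<lambda>x. A x + B x))"
    unfolding finite_dim_def using ST(1,2) by blast
  then show ?thesis
    using assms by (auto simp: finite_rank_def bounded_clinear_def ell2.scale_right_distrib
        intro: bounded_linear_add)
qed

lemma finite_rank_scaleC:
  assumes "finite_rank A"
  shows "finite_rank (\<lambda>x. c *\<^sub>C A x)"
proof -
  interpret A: bounded_linear A using assms by (simp add: finite_rank_def bounded_clinear_def)
  obtain K where K: "\<And>x. norm (A x) \<le> norm x * K" using A.bounded by blast
  have "bounded_linear (\<lambda>x. c *\<^sub>C A x)"
  proof (rule bounded_linear_intro)
    show "norm (c *\<^sub>C A x) \<le> norm x * (cmod c * K)" for x
      using mult_left_mono[OF K[of x], of "cmod c"] by (simp add: norm_scaleC mult_ac)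
  qed (simp_all add: A.add A.scaleR ell2.scale_right_distrib scaleR_ell2_def[of _ "_ *\<^sub>C _"] scaleR_ell2_def[of _ "A _"]
      ell2.scale_left_commute[of c] del: ell2.scale_scale)
  moreover have "finite_dim (range (\<lambda>x. c *\<^sub>C A x))"
    using assms unfolding finite_rank_def finite_dim_def by (blast intro: ell2.span_scale)
  ultimately show ?thesis
    using assms by (simp add: finite_rank_def bounded_clinear_def ell2.scale_left_commute[of c])
qed

lemma finite_rank_rank_one: "finite_rank (\<lambda>x. cinner u x *\<^sub>C v)"
proof -
  have "bounded_linear (\<lambda>x. cinner u x *\<^sub>C v)"
  proof (rule bounded_linear_intro)
    show "norm (cinner u x *\<^sub>C v) \<le> norm x * (norm u * norm v)" for x
      using mult_right_mono[OF cmod_cinner_le[of u x], of "norm v"]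
      by (simp add: norm_scaleC mult_ac)
  qed (simp_all add: scaleR_ell2_def cinner_add_right cinner_scaleC_right ell2.scale_left_distrib)
  moreover have "range (\<lambda>x. cinner u x *\<^sub>C v) \<subseteq> ell2.span {v}"
    by (auto intro: ell2.span_scale ell2.span_base)
  ultimately show ?thesis
    unfolding finite_rank_def bounded_clinear_def finite_dim_def
    by (auto simp: cinner_scaleC_right intro!: exI[of _ "{v}"])
qed

lemma has_trace_zero: "has_trace (\<lambda>x. 0) 0"
  by (simp add: has_trace_def finite_rank_zero)

lemma has_trace_add: "has_trace A s \<Longrightarrow> has_trace B t \<Longrightarrow> has_trace (\<lambda>x. A x + B x) (s + t)"
  by (simp add: has_trace_def finite_rank_add cinner_add_right sums_add)

lemma has_trace_scaleC: "has_trace A t \<Longrightarrow> has_trace (\<lambda>x. c *\<^sub>C A x) (c * t)"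
  by (simp add: has_trace_def finite_rank_scaleC cinner_scaleC_right sums_mult)

lemma has_trace_sum:
  "(\<And>i. i \<in> I \<Longrightarrow> has_trace (A i) (t i)) \<Longrightarrow> has_trace (\<lambda>x. \<Sum>i\<in>I. A i x) (\<Sum>i\<in>I. t i)"
  by (induction I rule: infinite_finite_induct) (simp_all add: has_trace_zero has_trace_add)

text \<open>The diagonal entries in a basis \<open>b\<close> are the terms of Parseval's series.
  Independence of the basis enters through this case alone.\<close>

lemma has_trace_rank_one: "has_trace (\<lambda>x. cinner u x *\<^sub>C v) (cinner u v)"
  by (simp add: has_trace_def finite_rank_rank_one cinner_scaleC_right onb_parseval)

section \<open>Toeplitz operators\<close>

lemma coord_shift_pow: "coord ((shift ^^ k) x) n = (if n < k then 0 else coord x (n - k))"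
  by (induction k arbitrary: n) (auto simp: shift.rep_eq)

lemma coord_backward_shift_pow: "coord ((backward_shift ^^ k) x) n = coord x (n + k)"
  by (induction k arbitrary: n) (auto simp: backward_shift.rep_eq)

text \<open>One formula for both signs of \<open>k\<close>: entry \<open>n\<close> comes from
  position \<open>n - k\<close>, and positions below 0 supply 0.\<close>

lemma coord_toeplitz_monom:
  "coord (toeplitz_monom k x) n = (if int n < k then 0 else coord x (nat (int n - k)))"
proof (cases k rule: int_cases2)
  case (nonneg m)
  then show ?thesis
    by (simp add: toeplitz_monom_def coord_shift_pow nat_minus_as_int)
next
  case (nonpos m)
  then show ?thesis
    \<comment> \<open>The case \<open>m = 0\<close> overlaps with the nonnegative one and takes the
      \<open>shift\<close> branch of the definition.\<close>
    by (cases "m = 0")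
      (simp_all add: toeplitz_monom_def cadjoint_shift coord_backward_shift_pow nat_int_add)
qed

lemma toeplitz_monom_sum_scaleC:
  "toeplitz_monom k (\<Sum>i\<in>I. c i *\<^sub>C x i) = (\<Sum>i\<in>I. c i *\<^sub>C toeplitz_monom k (x i))"
  by (rule ell2_eqI) (simp add: coord_toeplitz_monom)

text \<open>Both products shift by \<open>k + l\<close> and differ only in the truncation at the
  intermediate position: \<open>n - k\<close> for one order, \<open>n - l\<close> for the other.
  What remains is a weighted shift with weights in {-1, 0, 1}.\<close>

lemma coord_commutator_toeplitz_monom:
  "coord (commutator (toeplitz_monom k) (toeplitz_monom l) x) n =
    (if int n < k + l then 0
     else ((if int n < k then 0 else 1) - (if int n < l then 0 else 1))
       * coord x (nat (int n - (k + l))))"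
proof -
  have "coord (toeplitz_monom p (toeplitz_monom q x)) n =
      (if int n < p + q then 0 else (if int n < p then 0 else 1) * coord x (nat (int n - (p + q))))" for p q
    by (cases "int n < p") (simp_all add: coord_toeplitz_monom algebra_simps)
  then show ?thesis
    unfolding commutator_def coord_diff by (simp add: add.commute[of l] left_diff_distrib)
qed

lemma has_trace_commutator_toeplitz_monom:
  "has_trace (commutator (toeplitz_monom k) (toeplitz_monom l)) (if k + l = 0 then of_int l else 0)"
proof -
  define C where "C = commutator (toeplitz_monom k) (toeplitz_monom l)"
  \<comment> \<open>Large enough that coordinates from \<open>N\<close> on contribute nothing to
    \<open>C\<close>, and that the cutoffs \<open>k\<close> and \<open>l\<close> of the diagonal
    count do not exceed \<open>N\<close>.\<close>
  define N where "N = nat (max \<bar>k\<bar> \<bar>l\<bar>)"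
  have "C x = (\<Sum>j<N. cinner (basis_vec j) x *\<^sub>C C (basis_vec j))" for x
  proof (rule ell2_eqI)
    fix n
    show "coord (C x) n = coord (\<Sum>j<N. cinner (basis_vec j) x *\<^sub>C C (basis_vec j)) n"
    proof (cases "int n < k + l")
      case False
      define m where "m = nat (int n - (k + l))"
      define a :: complex where "a = (if int n < k then 0 else 1) - (if int n < l then 0 else 1)"
      have coord_C: "coord (C y) n = a * coord y m" for y
        using False by (simp add: C_def coord_commutator_toeplitz_monom a_def m_def)
      have "coord (\<Sum>j<N. cinner (basis_vec j) x *\<^sub>C C (basis_vec j)) n =
          (\<Sum>j<N. if m = j then a * coord x j else 0)"
        unfolding coord_sum coord_scaleC coord_C by (rule sum.cong) auto
      \<comment> \<open>Here \<open>n = m + k + l\<close>, so \<open>m \<ge> \<bar>l\<bar>\<close>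
        gives \<open>n \<ge> k\<close> and \<open>m \<ge> \<bar>k\<bar>\<close> gives
        \<open>n \<ge> l\<close>: neither product truncates.\<close>
      moreover have "a = 0" if "N \<le> m"
        using that False by (auto simp: a_def m_def N_def)
      ultimately show ?thesis by (auto simp: coord_C)
    qed (simp add: C_def coord_commutator_toeplitz_monom)
  qed
  then have "C = (\<lambda>x. \<Sum>j<N. cinner (basis_vec j) x *\<^sub>C C (basis_vec j))" by blast
  moreover have "has_trace \<dots> (\<Sum>j<N. cinner (basis_vec j) (C (basis_vec j)))"
    by (intro has_trace_sum has_trace_rank_one)
  moreover have "(\<Sum>j<N. cinner (basis_vec j) (C (basis_vec j))) = (if k + l = 0 then of_int l else 0)"
  proof (cases "k + l = 0")
    case True
    then have l: "l = - k" by simp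
    \<comment> \<open>The two indicators count \<open>nat (- k)\<close> and \<open>nat k\<close>
      sites; the difference is \<open>- k = l\<close> for either sign of \<open>k\<close>.\<close>
    have "(\<Sum>j<N. cinner (basis_vec j) (C (basis_vec j))) =
        (\<Sum>j<N. if int j < - k then 1 else 0) - (\<Sum>j<N. if int j < k then 1 else 0)"
      unfolding sum_subtractf[symmetric]
      by (rule sum.cong) (auto simp: C_def coord_commutator_toeplitz_monom l)
    also have "\<dots> = of_nat (card {j\<in>{..<N}. int j < - k}) - of_nat (card {j\<in>{..<N}. int j < k})"
      by (simp flip: sum.inter_filter)
    also have "{j\<in>{..<N}. int j < - k} = {..<nat (- k)}"
      by (auto simp: N_def l)
    also have "{j\<in>{..<N}. int j < k} = {..<nat k}"
      by (auto simp: N_def l)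
    finally show ?thesis using True l by (cases "k \<ge> 0") simp_all
  next
    case False
    \<comment> \<open>A shift by a nonzero amount moves every basis vector off itself, so the
      diagonal vanishes.\<close>
    then have "nat (int j - (k + l)) \<noteq> j" if "\<not> int j < k + l" for j
      using that by auto
    then show ?thesis
      using False by (auto simp: C_def coord_commutator_toeplitz_monom intro!: sum.neutral)
  qed
  ultimately show ?thesis by (simp add: C_def)
qed

lemma commutator_toeplitz:
  "commutator (toeplitz f) (toeplitz g) =
    (\<lambda>x. \<Sum>k\<in>Poly_Mapping.keys f. \<Sum>l\<in>Poly_Mapping.keys g.
      (Poly_Mapping.lookup f k * Poly_Mapping.lookup g l) *\<^sub>C
        commutator (toeplitz_monom k) (toeplitz_monom l) x)"
proof
  fix x
  have "toeplitz g (toeplitz f x) =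
      (\<Sum>k\<in>Poly_Mapping.keys f. \<Sum>l\<in>Poly_Mapping.keys g.
        (Poly_Mapping.lookup f k * Poly_Mapping.lookup g l) *\<^sub>C toeplitz_monom l (toeplitz_monom k x))"
    unfolding toeplitz_def toeplitz_monom_sum_scaleC
    \<comment> \<open>This product expands with the sum over the keys of \<open>g\<close> outside;
      the swap aligns it with the other product.\<close>
    by (subst sum.swap) (simp add: ell2.scale_sum_right mult.commute)
  then show "commutator (toeplitz f) (toeplitz g) x =
    (\<Sum>k\<in>Poly_Mapping.keys f. \<Sum>l\<in>Poly_Mapping.keys g.
      (Poly_Mapping.lookup f k * Poly_Mapping.lookup g l) *\<^sub>C
        commutator (toeplitz_monom k) (toeplitz_monom l) x)"
    unfolding commutator_def
    by (simp add: ell2.scale_right_diff_distrib sum_subtractf)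
      (simp add: toeplitz_def toeplitz_monom_sum_scaleC ell2.scale_sum_right)
qed

lemma has_trace_commutator_toeplitz:
  "has_trace (commutator (toeplitz f) (toeplitz g))
    (\<Sum>k\<in>Poly_Mapping.keys f. \<Sum>l\<in>Poly_Mapping.keys g.
      Poly_Mapping.lookup f k * Poly_Mapping.lookup g l * (if k + l = 0 then of_int l else 0))"
  unfolding commutator_toeplitz
  by (intro has_trace_sum has_trace_scaleC has_trace_commutator_toeplitz_monom)

lemma toeplitz_trig_monom: "toeplitz (trig_monom k) = toeplitz_monom k"
  by (simp add: fun_eq_iff toeplitz_def trig_monom_def)

section \<open>The contour integral\<close>

text \<open>Away from exponent -1 there is a primitive on the punctured plane; exponent -1 is
  Cauchy's formula for the constant function 1.\<close>

lemma has_contour_integral_powi_circlepath: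
  "((\<lambda>z. z powi m) has_contour_integral (if m = -1 then 2 * of_real pi * \<i> else 0)) (circlepath 0 1)"
proof (cases "m = -1")
  case True
  have "((\<lambda>z. 1 / (z - 0)) has_contour_integral 2 * of_real pi * \<i> * 1) (circlepath 0 1)"
    by (rule Cauchy_integral_circlepath_simple) auto
  then show ?thesis using True by (simp add: power_int_minus inverse_eq_divide)
next
  case False
  have "((\<lambda>z. z powi m) has_contour_integral 0) (circlepath 0 1)"
  proof (rule Cauchy_theorem_primitive)
    fix z :: complex assume "z \<in> - {0}"
    then have "((\<lambda>z. z powi (m + 1) / of_int (m + 1)) has_field_derivative
        of_int (m + 1) * z powi (m + 1 - 1) * 1 / of_int (m + 1)) (at z within - {0})"
      by (intro DERIV_cdivide DERIV_power_int DERIV_ident) auto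
    moreover have "of_int (m + 1) \<noteq> (0::complex)"
      using False by (subst of_int_eq_0_iff) simp
    ultimately show "((\<lambda>z. z powi (m + 1) / of_int (m + 1)) has_field_derivative z powi m) (at z within - {0})"
      by simp
  qed auto
  then show ?thesis using False by simp
qed

lemma deriv_trig_eval:
  assumes "z \<noteq> 0"
  shows "deriv (trig_eval g) z =
    (\<Sum>l\<in>Poly_Mapping.keys g. Poly_Mapping.lookup g l * (of_int l * z powi (l - 1)))"
proof (rule DERIV_imp_deriv)
  show "(trig_eval g has_field_derivative
      (\<Sum>l\<in>Poly_Mapping.keys g. Poly_Mapping.lookup g l * (of_int l * z powi (l - 1)))) (at z)"
    unfolding trig_eval_def[abs_def]
    using assms by (auto intro!: derivative_eq_intros sum.cong)
qed

text \<open>Expanding the product leaves powers \<open>z powi (k + l - 1)\<close>, of which only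
  those with \<open>k + l = 0\<close> integrate to something nonzero. The value is kept as the
  double sum that also expresses the trace.\<close>

lemma has_contour_integral_trig_eval:
  "((\<lambda>z. trig_eval f z * deriv (trig_eval g) z) has_contour_integral
    2 * of_real pi * \<i> * (\<Sum>k\<in>Poly_Mapping.keys f. \<Sum>l\<in>Poly_Mapping.keys g.
      Poly_Mapping.lookup f k * Poly_Mapping.lookup g l * (if k + l = 0 then of_int l else 0)))
    (circlepath 0 1)"
proof (rule has_contour_integral_eq)
  show "((\<lambda>z. \<Sum>k\<in>Poly_Mapping.keys f. \<Sum>l\<in>Poly_Mapping.keys g.
        Poly_Mapping.lookup f k * Poly_Mapping.lookup g l * of_int l * z powi (k + l - 1))
      has_contour_integral
    2 * of_real pi * \<i> * (\<Sum>k\<in>Poly_Mapping.keys f. \<Sum>l\<in>Poly_Mapping.keys g.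
      Poly_Mapping.lookup f k * Poly_Mapping.lookup g l * (if k + l = 0 then of_int l else 0)))
    (circlepath 0 1)"
    unfolding sum_distrib_left
  proof (intro has_contour_integral_sum finite_keys)
    fix k l
    show "((\<lambda>z. Poly_Mapping.lookup f k * Poly_Mapping.lookup g l * of_int l * z powi (k + l - 1))
        has_contour_integral 2 * of_real pi * \<i> *
          (Poly_Mapping.lookup f k * Poly_Mapping.lookup g l * (if k + l = 0 then of_int l else 0)))
        (circlepath 0 1)"
      using has_contour_integral_lmul[OF has_contour_integral_powi_circlepath[of "k + l - 1"],
          of "Poly_Mapping.lookup f k * Poly_Mapping.lookup g l * of_int l"]
      by (cases "k + l = 0") (simp_all add: mult_ac)
  qed
next
  fix z :: complex assume "z \<in> path_image (circlepath 0 1)"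
  then have "z \<noteq> 0" by auto
  \<comment> \<open>The circle avoids the origin, so the addition law holds for negative exponents
    too.\<close>
  then have "z powi (k + l - 1) = z powi k * z powi (l - 1)" for k l
    by (simp flip: power_int_add add: add_diff_eq)
  then show "(\<Sum>k\<in>Poly_Mapping.keys f. \<Sum>l\<in>Poly_Mapping.keys g.
        Poly_Mapping.lookup f k * Poly_Mapping.lookup g l * of_int l * z powi (k + l - 1)) =
      trig_eval f z * deriv (trig_eval g) z"
    by (simp add: deriv_trig_eval[OF \<open>z \<noteq> 0\<close>] trig_eval_def sum_product mult_ac)
qed

section \<open>Powers of the shift\<close>

text \<open>Pairing with the basis vectors determines every coordinate of \<open>B y\<close>, so the
  defining equation has at most one solution.\<close>

lemma cadjoint_eqI:
  assumes "\<And>x y. cinner (A x) y = cinner x (B y)"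
  shows "cadjoint A = B"
  unfolding cadjoint_def
proof (rule the_equality)
  fix B' assume B': "\<forall>x y. cinner (A x) y = cinner x (B' y)"
  show "B' = B"
  proof (rule ext, rule ell2_eqI)
    show "coord (B' y) n = coord (B y) n" for y n
      using B'[rule_format, of "basis_vec n" y] assms[of "basis_vec n" y] by simp
  qed
qed (use assms in blast)

text \<open>The first \<open>n\<close> terms of the pairing with \<open>(shift ^^ n) x\<close>
  vanish; the rest, reindexed, is the pairing with the backward shift.\<close>

lemma cadjoint_shift_pow: "cadjoint (shift ^^ n) = backward_shift ^^ n"
proof (rule cadjoint_eqI)
  fix x y
  show "cinner ((shift ^^ n) x) y = cinner x ((backward_shift ^^ n) y)"
    unfolding cinner_def
    using suminf_split_initial_segment[OF summable_cinner, of "(shift ^^ n) x" y n]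
    by (simp add: coord_shift_pow coord_backward_shift_pow)
qed

lemma norm_shift_pow: "norm ((shift ^^ n) x) = norm x"
proof (rule power2_eq_imp_eq)
  show "(norm ((shift ^^ n) x))\<^sup>2 = (norm x)\<^sup>2"
    unfolding norm_ell2_sq
    using suminf_split_initial_segment[OF summable_coord, of "(shift ^^ n) x" n]
    by (simp add: coord_shift_pow)
qed auto

lemma bounded_clinear_shift_pow: "bounded_clinear (shift ^^ n)"
  unfolding bounded_clinear_def
proof (intro conjI allI)
  show scale: "(shift ^^ n) (c *\<^sub>C x) = c *\<^sub>C (shift ^^ n) x" for c x
    by (rule ell2_eqI) (simp add: coord_shift_pow)
  show "bounded_linear (shift ^^ n)"
  proof (rule bounded_linear_intro)
    show "(shift ^^ n) (x + y) = (shift ^^ n) x + (shift ^^ n) y" for x y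
      by (rule ell2_eqI) (simp add: coord_shift_pow)
    show "norm ((shift ^^ n) x) \<le> norm x * 1" for x by (simp add: norm_shift_pow)
  qed (simp add: scaleR_ell2_def scale)
qed

lemma bounded_linear_coord: "bounded_linear (\<lambda>x. coord x n)"
proof (rule bounded_linear_intro)
  show "norm (coord x n) \<le> norm x * 1" for x by (simp add: cmod_coord_le)
qed (simp_all add: scaleR_ell2_def scaleR_conv_of_real)

lemma backward_shift_pow_shift_pow: "(backward_shift ^^ n) ((shift ^^ n) x) = x"
  by (rule ell2_eqI) (simp add: coord_backward_shift_pow coord_shift_pow)

lemma ker_shift_pow: "ker (shift ^^ n) = {0}"
proof -
  have "x = 0" if "(shift ^^ n) x = 0" for x
    using norm_shift_pow[of n x] that by simp
  moreover have "(shift ^^ n) 0 = 0" by (rule ell2_eqI) (simp add: coord_shift_pow)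
  ultimately show ?thesis by (auto simp: ker_def)
qed

text \<open>The operator drops the first \<open>n\<close> coordinates and keeps the others, so its
  kernel consists of the vectors supported on \<open>j < n\<close>.\<close>

lemma ker_backward_shift_pow: "ker (backward_shift ^^ n) = ell2.span (basis_vec ` {..<n})"
proof (intro equalityI subsetI)
  fix x assume "x \<in> ker (backward_shift ^^ n)"
  then have x: "(backward_shift ^^ n) x = 0" by (simp add: ker_def)
  have "coord x k = 0" if "n \<le> k" for k
    using coord_backward_shift_pow[of n x "k - n"] that by (simp add: x)
  then have "x = (\<Sum>j<n. coord x j *\<^sub>C basis_vec j)" by (rule sum_coord_basis_vec)
  also have "\<dots> \<in> ell2.span (basis_vec ` {..<n})"
    by (intro ell2.span_sum ell2.span_scale ell2.span_base) auto
  finally show "x \<in> ell2.span (basis_vec ` {..<n})" .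
next
  fix x assume "x \<in> ell2.span (basis_vec ` {..<n})"
  moreover have "ell2.span (basis_vec ` {..<n}) \<subseteq> ker (backward_shift ^^ n)"
  proof (rule ell2.span_minimal)
    have "x \<in> ker (backward_shift ^^ n) \<longleftrightarrow> (\<forall>k. coord x (k + n) = 0)" for x
      unfolding ker_def by (metis (mono_tags) coord_backward_shift_pow coord_zero ell2_eqI mem_Collect_eq)
    then show "basis_vec ` {..<n} \<subseteq> ker (backward_shift ^^ n)" "ell2.subspace (ker (backward_shift ^^ n))"
      by (auto simp: ell2.subspace_def)
  qed
  ultimately show "x \<in> ker (backward_shift ^^ n)" by blast
qed

text \<open>The backward shift provides the preimage. In this form the range is a finite
  intersection of zero sets of continuous functionals, hence closed.\<close>

lemma range_shift_pow: "range (shift ^^ n) = (\<Inter>j\<in>{..<n}. {x. coord x j = 0})"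
proof (intro equalityI subsetI)
  fix x assume x: "x \<in> (\<Inter>j\<in>{..<n}. {x. coord x j = 0})"
  have "x = (shift ^^ n) ((backward_shift ^^ n) x)"
    by (rule ell2_eqI) (use x in \<open>auto simp: coord_shift_pow coord_backward_shift_pow\<close>)
  then show "x \<in> range (shift ^^ n)" by blast
qed (auto simp: coord_shift_pow)

lemma fredholm_shift_pow: "fredholm (shift ^^ n)"
proof -
  have "closed (range (shift ^^ n))"
    unfolding range_shift_pow
    by (intro closed_INT ballI closed_Collect_eq continuous_intros
        linear_continuous_on bounded_linear_coord)
  moreover have "finite_dim (ker (shift ^^ n))"
    unfolding ker_shift_pow finite_dim_def by (rule exI[of _ "{}"]) simp
  moreover have "finite_dim (ker (cadjoint (shift ^^ n)))"
    unfolding cadjoint_shift_pow ker_backward_shift_pow finite_dim_def by blast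
  ultimately show ?thesis by (simp add: fredholm_def bounded_clinear_shift_pow)
qed

lemma fredholm_index_shift_pow: "fredholm_index (shift ^^ n) = - int n"
proof -
  have "ell2.dim {0} = 0"
    using ell2.dim_span_eq_card_independent[OF ell2.independent_empty] by simp
  moreover have "ell2.dim (ell2.span (basis_vec ` {..<n})) = n"
    using ell2.dim_span_eq_card_independent[OF independent_basis_vec]
    by (simp add: card_image inj_on_subset[OF inj_basis_vec])
  ultimately show ?thesis
    by (simp add: fredholm_index_def ker_shift_pow cadjoint_shift_pow ker_backward_shift_pow)
qed

lemma omega_shift_pow:
  "omega j (shift ^^ n) (cadjoint shift ^^ n) = - (if j < n then 1 else 0)"
  by (simp add: omega_def commutator_def cadjoint_shift backward_shift_pow_shift_pow
      coord_shift_pow coord_backward_shift_pow)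

theorem theorem4p2:
  "(\<forall>f g :: trig_poly.
      finite_rank (commutator (toeplitz f) (toeplitz g)) \<and>
      (\<lambda>j. omega j (toeplitz f) (toeplitz g)) sums op_trace (commutator (toeplitz f) (toeplitz g)) \<and>
      op_trace (commutator (toeplitz f) (toeplitz g)) =
        1 / (2 * of_real pi * \<i>) *
          contour_integral (circlepath 0 1) (\<lambda>z. trig_eval f z * deriv (trig_eval g) z)) \<and>
    (\<forall>n::nat. n \<ge> 1 \<longrightarrow>
      toeplitz (trig_monom (int n)) = shift ^^ n \<and>
      toeplitz (trig_monom (- int n)) = cadjoint shift ^^ n \<and>
      (\<lambda>j. omega j (shift ^^ n) (cadjoint shift ^^ n)) sums (- of_nat n) \<and>
      fredholm (shift ^^ n) \<and>
      fredholm_index (shift ^^ n) = - int n \<and>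
      (\<forall>j. omega j (shift ^^ n) (cadjoint shift ^^ n) = - (if j < n then 1 else 0)) \<and>
      of_int (fredholm_index (shift ^^ n)) =
        (\<Sum>j<n. omega j (shift ^^ n) (cadjoint shift ^^ n)))"
proof (intro conjI allI impI)
  fix f g :: trig_poly
  let ?C = "commutator (toeplitz f) (toeplitz g)"
  note trace = has_trace_commutator_toeplitz[of f g]
  show "finite_rank ?C" using trace by (simp add: has_trace_def)
  show "(\<lambda>j. omega j (toeplitz f) (toeplitz g)) sums op_trace ?C"
    \<comment> \<open>In the canonical basis the trace series is the series of the
      \<open>omega j\<close>.\<close>
    using trace is_onb_basis_vec unfolding op_trace_eqI[OF trace] omega_def has_trace_def by blast
  show "op_trace ?C = 1 / (2 * of_real pi * \<i>) *
      contour_integral (circlepath 0 1) (\<lambda>z. trig_eval f z * deriv (trig_eval g) z)"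
    unfolding op_trace_eqI[OF trace] contour_integral_unique[OF has_contour_integral_trig_eval]
    by simp
next
  fix n :: nat
  have sum: "(\<Sum>j<n. omega j (shift ^^ n) (cadjoint shift ^^ n)) = - of_nat n"
    by (simp add: omega_shift_pow)
  assume "n \<ge> 1"
  show "toeplitz (trig_monom (int n)) = shift ^^ n"
    by (simp add: toeplitz_trig_monom toeplitz_monom_def)
  show "toeplitz (trig_monom (- int n)) = cadjoint shift ^^ n"
    \<comment> \<open>The exponent is strictly negative, which selects the adjoint branch of
      \<open>toeplitz_monom\<close>.\<close>
    using \<open>n \<ge> 1\<close> by (simp add: toeplitz_trig_monom toeplitz_monom_def)
  show "(\<lambda>j. omega j (shift ^^ n) (cadjoint shift ^^ n)) sums (- of_nat n)"
    unfolding sum[symmetric] by (rule sums_finite) (auto simp: omega_shift_pow)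
  show "fredholm (shift ^^ n)" by (fact fredholm_shift_pow)
  show "fredholm_index (shift ^^ n) = - int n" by (fact fredholm_index_shift_pow)
  show "omega j (shift ^^ n) (cadjoint shift ^^ n) = - (if j < n then 1 else 0)" for j
    by (fact omega_shift_pow)
  show "of_int (fredholm_index (shift ^^ n)) = (\<Sum>j<n. omega j (shift ^^ n) (cadjoint shift ^^ n))"
    unfolding sum by (simp add: fredholm_index_shift_pow)
qed

end
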